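(* Let $M=\mathrm{Span}\{e_{11},e_{12},e_{13},e_{22},e_{33}\}$. Let $M_3(\mathbb{C})=A\oplus B$ be a direct vector-space sum of two subalgebras with $\dim A=4$ and $\dim B=5$, where $B$ is the image of $M$ under some automorphism or antiautomorphism of $M_3(\mathbb{C})$. Then there is a map $\varphi\colon M_3(\mathbb{C})\to M_3(\mathbb{C})$, which is an automorphism or an antiautomorphism of $M_3(\mathbb{C})$, such that $\varphi(B)=M$ and $\varphi(A)=S$, where $S$ is one of the following subalgebras (with parameters $x,d,c\in\mathbb{C}$): (Y1) $\mathrm{Span}\{e_{21},\ e_{31},\ e_{32}+e_{33},\ e_{22}+e_{23}\}$; (Y2) $\mathrm{Span}\{e_{21},\ e_{31},\ e_{22}+e_{32},\ e_{23}+e_{33}\}$; (Y3) $\mathrm{Span}\{e_{21},\ e_{31},\ e_{11}+e_{22}+e_{23},\ e_{11}+e_{32}+e_{33}\}$; (Y4) $\mathrm{Span}\{e_{21},\ e_{31},\ e_{11}+e_{22}+e_{32},\ e_{11}+e_{23}+e_{33}\}$; (Y5) $\mathrm{Span}\{e_{21}+e_{22},\ e_{31}-e_{33},\ e_{32}+e_{33},\ e_{22}+e_{23}\}$; (Y6) $\mathrm{Span}\{e_{21}-e_{31},\ e_{12}+e_{13}+e_{31},\ e_{11}+e_{32}+e_{33},\ e_{11}+e_{22}+e_{23}\}$; (Y7) $\mathrm{Span}\{e_{21}-e_{23},\ e_{11}+e_{21}+e_{31},\ e_{12}+e_{22}+e_{32},\ e_{13}+e_{23}+e_{33}\}$; (Y8)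 $\mathrm{Span}\{e_{21}+e_{22}+e_{33},\ e_{21}+e_{31},\ e_{11}+e_{12}-e_{13}+e_{22}+e_{32},\ e_{22}-e_{23}+e_{32}-e_{33}\}$; (Y9) $\mathrm{Span}\{e_{21}+e_{22}-(x+1)e_{23},\ xe_{11}+e_{21}+e_{31},\ xe_{12}+e_{22}+e_{32},\ xe_{13}+e_{23}+e_{33}\}$; (Y10) $\mathrm{Span}\{e_{21}+de_{22},\ e_{11}+e_{31}+d(e_{12}+e_{32}),\ e_{22}+e_{23},\ e_{12}+e_{13}+e_{32}+e_{33}\}$; (Y11) $\mathrm{Span}\{e_{21}-e_{31}+e_{22}+e_{33},\ c(e_{12}+e_{13})+e_{21}+e_{22},\ e_{11}+e_{12}+e_{32}+e_{33},\ e_{11}-e_{13}+e_{22}+e_{23}\}$.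
   Context: $M_3(\mathbb{C})$ is the algebra of $3\times3$ complex matrices, $e_{ij}$ are the matrix units, and $\mathrm{Span}$ means linear span over $\mathbb{C}$. A subalgebra is a $\mathbb{C}$-linear subspace closed under multiplication; it is not required to contain the identity matrix. An automorphism is a $\mathbb{C}$-algebra automorphism of $M_3(\mathbb{C})$; an antiautomorphism is the composition of an automorphism and the transpose map. The phrase "up to transpose and up to action of $\mathrm{Aut}(M_3(\mathbb{C}))$" is expressed in the claim by the existence of $\varphi$. *)

theory Defs
  imports "HOL-Analysis.Analysis"
begin

type_synonym cmat3 = "complex ^ 3 ^ 3"

(* The library equips complex ^ 3 ^ 3 only with its real vector space structure; complex spans,
   dimensions and linear maps are those of the library's vector_space locale for this scaling. *)
definition cscale :: "complex \<Rightarrow> cmat3 \<Rightarrow> cmat3"  (infixr \<open>*\<^sub>C\<close> 75)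
  where "c *\<^sub>C X = (\<chi> i j. c * X $ i $ j)"

interpretation cmat: vector_space cscale
  by unfold_locales (simp_all add: cscale_def vec_eq_iff algebra_simps)

(* Row i, column j. The index type 3 has exactly the elements 1, 2, 3 (with 3 = 0). *)
definition E :: "3 \<Rightarrow> 3 \<Rightarrow> cmat3"
  where "E i j = axis i (axis j 1)"

definition subalgebra :: "cmat3 set \<Rightarrow> bool"
  where "subalgebra A \<longleftrightarrow> cmat.subspace A \<and> (\<forall>X\<in>A. \<forall>Y\<in>A. X ** Y \<in> A)"

definition direct_sum_decomposition :: "cmat3 set \<Rightarrow> cmat3 set \<Rightarrow> bool"
  where "direct_sum_decomposition A B \<longleftrightarrow>
    {X + Y |X Y. X \<in> A \<and> Y \<in> B} = UNIV \<and> A \<inter> B = {0}"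

definition automorphism :: "(cmat3 \<Rightarrow> cmat3) \<Rightarrow> bool"
  where "automorphism f \<longleftrightarrow>
    Vector_Spaces.linear cscale cscale f \<and> bij f \<and>
    f (mat 1) = mat 1 \<and> (\<forall>X Y. f (X ** Y) = f X ** f Y)"

definition antiautomorphism :: "(cmat3 \<Rightarrow> cmat3) \<Rightarrow> bool"
  where "antiautomorphism f \<longleftrightarrow> (\<exists>g. automorphism g \<and> f = g \<circ> transpose)"

definition M :: "cmat3 set"
  where "M = cmat.span {E 1 1, E 1 2, E 1 3, E 2 2, E 3 3}"

end

theory Submission
  imports Defs
begin

text \<open>
  Pulling everything back along the inverse of the map that carries \<open>M\<close> to \<open>B\<close> reduces the theorem
  to \<open>B = M\<close>. The matrices of \<open>M\<close> are those whose entries \<open>21, 31, 23, 32\<close> vanish, so a subspace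
  complementary to \<open>M\<close> is the graph of a linear map: each of its elements is determined by these four
  entries, which can be prescribed freely. Closure under multiplication becomes a system of
  polynomial equations for that map. It is solved up to conjugation by the invertible elements
  of \<open>M\<close>, i.e. by unipotent matrices with first row \<open>(1, s, t)\<close> and by diagonal matrices.

  The equations are triangular for the following reason. The elements of \<open>A\<close> with vanishing \<open>21\<close> and
  \<open>31\<close> entries form a two-dimensional subalgebra, the stabilizer in \<open>A\<close> of the line through the first
  basis vector. Its lower right \<open>2 \<times> 2\<close> blocks form a subalgebra of the \<open>2 \<times> 2\<close> matrices that is
  complementary to the diagonal, and there are only two of those up to diagonal conjugation: the
  matrices with equal columns and the matrices with equal rows. (These are called the row type,
  \<open>w (1, 1)\<close>, and the column type, \<open>(1, 1)\<^sup>T w\<close>, below.) The \<open>11\<close> entry is a multiplicative functional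
  on this stabilizer, and the multiplication table of the generators \<open>P\<close> and \<open>Q\<close> (the elements whose entries
  \<open>(23, 32)\<close> are \<open>(1, 0)\<close> and \<open>(0, 1)\<close>), which are idempotent, forces it to be \<open>0\<close> on both or \<open>1\<close> on both. The remaining
  entries \<open>12\<close> and \<open>13\<close> form a cocycle, which is always a coboundary, i.e. a unipotent conjugation
  removes it. This leaves four stabilizers.

  For each of them, \<open>A\<close> is spanned by the stabilizer and by the elements \<open>Z\<close> and \<open>W\<close> whose entries
  \<open>(21, 31, 23, 32)\<close> are \<open>(1, 0, 0, 0)\<close> and \<open>(0, 1, 0, 0)\<close>. The products of \<open>Z\<close> and \<open>W\<close> with the
  stabilizer leave at most two parameters (one quadratic relation, from \<open>Z\<^sup>2\<close>, enters
  as well for the column type with functional \<open>0\<close>), and the conjugations that fix the stabilizer reduce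
  these to at most one parameter, which is either \<open>0\<close> or can be scaled to \<open>1\<close>.
\<close>

section \<open>Matrices by their nine entries\<close>

definition m3 :: "complex \<Rightarrow> complex \<Rightarrow> complex \<Rightarrow> complex \<Rightarrow> complex \<Rightarrow> complex \<Rightarrow> complex \<Rightarrow> complex
    \<Rightarrow> complex \<Rightarrow> cmat3"
  where "m3 a b c d e f g h k = vector [vector [a, b, c], vector [d, e, f], vector [g, h, k]]"

lemma m3_nth [simp]:
  "m3 a b c d e f g h k $ 1 $ 1 = a" "m3 a b c d e f g h k $ 1 $ 2 = b" "m3 a b c d e f g h k $ 1 $ 3 = c"
  "m3 a b c d e f g h k $ 2 $ 1 = d" "m3 a b c d e f g h k $ 2 $ 2 = e" "m3 a b c d e f g h k $ 2 $ 3 = f"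
  "m3 a b c d e f g h k $ 3 $ 1 = g" "m3 a b c d e f g h k $ 3 $ 2 = h" "m3 a b c d e f g h k $ 3 $ 3 = k"
  by (simp_all add: m3_def)

lemma cmat3_eq_iff:
  "X = (Y :: cmat3) \<longleftrightarrow>
    X $ 1 $ 1 = Y $ 1 $ 1 \<and> X $ 1 $ 2 = Y $ 1 $ 2 \<and> X $ 1 $ 3 = Y $ 1 $ 3 \<and>
    X $ 2 $ 1 = Y $ 2 $ 1 \<and> X $ 2 $ 2 = Y $ 2 $ 2 \<and> X $ 2 $ 3 = Y $ 2 $ 3 \<and>
    X $ 3 $ 1 = Y $ 3 $ 1 \<and> X $ 3 $ 2 = Y $ 3 $ 2 \<and> X $ 3 $ 3 = Y $ 3 $ 3"
  by (auto simp: vec_eq_iff forall_3)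

lemma m3_eq_iff:
  "m3 a b c d e f g h k = m3 a' b' c' d' e' f' g' h' k' \<longleftrightarrow>
    a = a' \<and> b = b' \<and> c = c' \<and> d = d' \<and> e = e' \<and> f = f' \<and> g = g' \<and> h = h' \<and> k = k'"
  by (simp add: cmat3_eq_iff)

lemma m3_eta:
  "X = m3 (X $ 1 $ 1) (X $ 1 $ 2) (X $ 1 $ 3) (X $ 2 $ 1) (X $ 2 $ 2) (X $ 2 $ 3)
    (X $ 3 $ 1) (X $ 3 $ 2) (X $ 3 $ 3)"
  by (simp add: cmat3_eq_iff)

lemma m3_add:
  "m3 a b c d e f g h k + m3 a' b' c' d' e' f' g' h' k' =
    m3 (a + a') (b + b') (c + c') (d + d') (e + e') (f + f') (g + g') (h + h') (k + k')"
  by (simp add: cmat3_eq_iff)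

lemma m3_diff:
  "m3 a b c d e f g h k - m3 a' b' c' d' e' f' g' h' k' =
    m3 (a - a') (b - b') (c - c') (d - d') (e - e') (f - f') (g - g') (h - h') (k - k')"
  by (simp add: cmat3_eq_iff)

lemma m3_cscale: "x *\<^sub>C m3 a b c d e f g h k =
    m3 (x * a) (x * b) (x * c) (x * d) (x * e) (x * f) (x * g) (x * h) (x * k)"
  by (simp add: cmat3_eq_iff cscale_def)

lemma m3_one: "mat 1 = m3 1 0 0 0 1 0 0 0 1"
  by (simp add: cmat3_eq_iff mat_def)

lemma m3_mult:
  "m3 a b c d e f g h k ** m3 a' b' c' d' e' f' g' h' k' =
    m3 (a*a' + b*d' + c*g') (a*b' + b*e' + c*h') (a*c' + b*f' + c*k')
       (d*a' + e*d' + f*g') (d*b' + e*e' + f*h') (d*c' + e*f' + f*k')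
       (g*a' + h*d' + k*g') (g*b' + h*e' + k*h') (g*c' + h*f' + k*k')"
  by (simp add: cmat3_eq_iff matrix_matrix_mult_def sum_3)

lemma E_m3:
  "E 1 1 = m3 1 0 0 0 0 0 0 0 0" "E 1 2 = m3 0 1 0 0 0 0 0 0 0" "E 1 3 = m3 0 0 1 0 0 0 0 0 0"
  "E 2 1 = m3 0 0 0 1 0 0 0 0 0" "E 2 2 = m3 0 0 0 0 1 0 0 0 0" "E 2 3 = m3 0 0 0 0 0 1 0 0 0"
  "E 3 1 = m3 0 0 0 0 0 0 1 0 0" "E 3 2 = m3 0 0 0 0 0 0 0 1 0" "E 3 3 = m3 0 0 0 0 0 0 0 0 1"
  by (simp_all add: cmat3_eq_iff E_def axis_def)

lemmas m3_simps = m3_add m3_diff m3_cscale m3_mult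

lemma cscale_nth: "(c *\<^sub>C X) $ i $ j = c * X $ i $ j"
  by (simp add: cscale_def)

lemma mem_M_iff: "X \<in> M \<longleftrightarrow> X $ 2 $ 1 = 0 \<and> X $ 3 $ 1 = 0 \<and> X $ 2 $ 3 = 0 \<and> X $ 3 $ 2 = 0"
proof
  have "cmat.subspace {X. X $ 2 $ 1 = 0 \<and> X $ 3 $ 1 = 0 \<and> X $ 2 $ 3 = 0 \<and> X $ 3 $ 2 = 0}"
    by (auto simp: cmat.subspace_def cscale_nth)
  moreover have "{E 1 1, E 1 2, E 1 3, E 2 2, E 3 3} \<subseteq>
      {X. X $ 2 $ 1 = 0 \<and> X $ 3 $ 1 = 0 \<and> X $ 2 $ 3 = 0 \<and> X $ 3 $ 2 = 0}"
    by (simp add: E_m3)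
  ultimately have "M \<subseteq> {X. X $ 2 $ 1 = 0 \<and> X $ 3 $ 1 = 0 \<and> X $ 2 $ 3 = 0 \<and> X $ 3 $ 2 = 0}"
    unfolding M_def by (rule cmat.span_minimal[rotated])
  then show "X \<in> M \<Longrightarrow> X $ 2 $ 1 = 0 \<and> X $ 3 $ 1 = 0 \<and> X $ 2 $ 3 = 0 \<and> X $ 3 $ 2 = 0"
    by blast
next
  assume *: "X $ 2 $ 1 = 0 \<and> X $ 3 $ 1 = 0 \<and> X $ 2 $ 3 = 0 \<and> X $ 3 $ 2 = 0"
  have "X = X $ 1 $ 1 *\<^sub>C E 1 1 + X $ 1 $ 2 *\<^sub>C E 1 2 + X $ 1 $ 3 *\<^sub>C E 1 3
      + X $ 2 $ 2 *\<^sub>C E 2 2 + X $ 3 $ 3 *\<^sub>C E 3 3"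
    using * by (simp add: E_m3 cmat3_eq_iff cscale_nth)
  also have "\<dots> \<in> M"
    unfolding M_def by (intro cmat.span_add cmat.span_scale cmat.span_base) auto
  finally show "X \<in> M" .
qed

section \<open>Automorphisms and antiautomorphisms\<close>

lemma automorphism_add: "automorphism f \<Longrightarrow> f (X + Y) = f X + f Y"
  by (simp add: automorphism_def Vector_Spaces.linear_iff)

lemma automorphism_cscale: "automorphism f \<Longrightarrow> f (c *\<^sub>C X) = c *\<^sub>C f X"
  by (simp add: automorphism_def Vector_Spaces.linear_iff)

lemma automorphism_mult: "automorphism f \<Longrightarrow> f (X ** Y) = f X ** f Y"
  by (simp add: automorphism_def)

lemma automorphism_bij: "automorphism f \<Longrightarrow> bij f"
  by (simp add: automorphism_def)

lemma automorphismI: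
  assumes "\<And>X Y. f (X + Y) = f X + f Y" and "\<And>c X. f (c *\<^sub>C X) = c *\<^sub>C f X"
    and "bij f" and "f (mat 1) = mat 1" and "\<And>X Y. f (X ** Y) = f X ** f Y"
  shows "automorphism f"
  using assms by (simp add: automorphism_def Vector_Spaces.linear_iff cmat.vector_space_axioms)

lemma automorphism_id: "automorphism id"
  by (rule automorphismI) auto

lemma automorphism_comp: "automorphism f \<Longrightarrow> automorphism g \<Longrightarrow> automorphism (g \<circ> f)"
  unfolding automorphism_def by (auto intro: Vector_Spaces.linear_compose bij_comp)

lemma automorphism_inv:
  assumes f: "automorphism f"
  shows "automorphism (inv f)"
proof -
  have inj: "inv f (f X) = X" and surj: "f (inv f X) = X" for X
    using automorphism_bij[OF f] by (simp_all add: bij_is_inj bij_is_surj surj_f_inv_f)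
  have inv_eq: "inv f X = Y" if "X = f Y" for X Y
    using that inj by simp
  show ?thesis
  proof (rule automorphismI)
    show "bij (inv f)"
      by (rule bij_imp_bij_inv[OF automorphism_bij[OF f]])
  qed (rule inv_eq; simp add: automorphism_add[OF f] automorphism_cscale[OF f]
      automorphism_mult[OF f] surj f[unfolded automorphism_def])+
qed

lemma transpose_cscale: "transpose (c *\<^sub>C X) = c *\<^sub>C transpose X"
  by (simp add: transpose_def cscale_def vec_eq_iff)

lemma transpose_add: "transpose (X + Y) = transpose X + transpose (Y :: cmat3)"
  by (simp add: transpose_def vec_eq_iff)

lemma bij_transpose: "bij (transpose :: cmat3 \<Rightarrow> cmat3)"
  by (rule o_bij[of transpose]) (auto simp: fun_eq_iff)

lemma automorphism_transpose_conj:
  assumes f: "automorphism f"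
  shows "automorphism (transpose \<circ> f \<circ> transpose)"
proof (rule automorphismI)
  show "bij (transpose \<circ> f \<circ> transpose)"
    by (intro bij_comp bij_transpose automorphism_bij[OF f])
qed (use f in \<open>simp_all add: automorphism_add automorphism_cscale automorphism_mult
    transpose_add transpose_cscale matrix_transpose_mul automorphism_def\<close>)

lemma antiautomorphism_comp:
  assumes "automorphism g" and "antiautomorphism f"
  shows "antiautomorphism (g \<circ> f)"
  using assms automorphism_comp unfolding antiautomorphism_def by (metis comp_assoc)

text \<open>
  The inverse of \<open>g \<circ> transpose\<close> is \<open>transpose \<circ> inv g\<close>, in which the transpose stands on the wrong side;
  conjugating \<open>inv g\<close> by the transpose moves it to the right.
\<close>
lemma antiautomorphism_inv:
  assumes "antiautomorphism f"
  shows "antiautomorphism (inv f)"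
proof -
  obtain g where g: "automorphism g" and f: "f = g \<circ> transpose"
    using assms by (auto simp: antiautomorphism_def)
  have "inv f = inv transpose \<circ> inv g"
    unfolding f by (rule o_inv_distrib[OF automorphism_bij[OF g] bij_transpose])
  also have "inv (transpose :: cmat3 \<Rightarrow> cmat3) = transpose"
    by (rule inv_unique_comp) (auto simp: fun_eq_iff)
  finally have "inv f = (transpose \<circ> inv g \<circ> transpose) \<circ> transpose"
    by (simp add: fun_eq_iff)
  then show ?thesis
    using automorphism_transpose_conj[OF automorphism_inv[OF g]]
    by (auto simp: antiautomorphism_def)
qed

lemma
  assumes "automorphism f \<or> antiautomorphism f"
  shows aut_or_anti_add: "f (X + Y) = f X + f Y"
    and aut_or_anti_cscale: "f (c *\<^sub>C X) = c *\<^sub>C f X"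
    and aut_or_anti_bij: "bij f"
  using assms
  by (auto simp: antiautomorphism_def automorphism_add automorphism_cscale
      automorphism_bij transpose_add transpose_cscale
      intro!: bij_comp bij_transpose)

lemma aut_or_anti_zero:
  assumes "automorphism f \<or> antiautomorphism f"
  shows "f 0 = 0"
  using aut_or_anti_add[OF assms, of 0 0] by simp

lemma subalgebra_image:
  assumes f: "automorphism f \<or> antiautomorphism f" and A: "subalgebra A"
  shows "subalgebra (f ` A)"
  unfolding subalgebra_def cmat.subspace_def
proof (intro conjI ballI allI)
  have sub: "cmat.subspace A" and mult: "\<And>X Y. X \<in> A \<Longrightarrow> Y \<in> A \<Longrightarrow> X ** Y \<in> A"
    using A by (auto simp: subalgebra_def)
  show "0 \<in> f ` A"
    using aut_or_anti_zero[OF f] cmat.subspace_0[OF sub] by (metis imageI)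
  show "X + Y \<in> f ` A" if "X \<in> f ` A" "Y \<in> f ` A" for X Y
    using that cmat.subspace_add[OF sub] by (auto simp flip: aut_or_anti_add[OF f])
  show "c *\<^sub>C X \<in> f ` A" if "X \<in> f ` A" for c X
    using that cmat.subspace_scale[OF sub] by (auto simp flip: aut_or_anti_cscale[OF f])
  show "X ** Y \<in> f ` A" if XY: "X \<in> f ` A" "Y \<in> f ` A" for X Y
  proof -
    obtain X' Y' where *: "X' \<in> A" "Y' \<in> A" "X = f X'" "Y = f Y'"
      using XY by auto
    have "f (X' ** Y') = X ** Y \<or> f (Y' ** X') = X ** Y"
    proof (cases "automorphism f")
      case True
      then show ?thesis by (simp add: * automorphism_mult)
    next
      case False
      then obtain g where "automorphism g" "f = g \<circ> transpose"
        using f by (auto simp: antiautomorphism_def)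
      then show ?thesis by (simp add: * automorphism_mult matrix_transpose_mul)
    qed
    then show ?thesis
      using mult * by (metis imageI)
  qed
qed

lemma direct_sum_decomposition_image:
  assumes f: "automorphism f \<or> antiautomorphism f" and d: "direct_sum_decomposition A B"
  shows "direct_sum_decomposition (f ` A) (f ` B)"
  unfolding direct_sum_decomposition_def
proof
  have "{X + Y |X Y. X \<in> f ` A \<and> Y \<in> f ` B} = f ` {X + Y |X Y. X \<in> A \<and> Y \<in> B}"
    by (auto simp: aut_or_anti_add[OF f] image_iff) (metis aut_or_anti_add[OF f])+
  also have "\<dots> = UNIV"
    using d bij_is_surj[OF aut_or_anti_bij[OF f]] by (simp add: direct_sum_decomposition_def)
  finally show "{X + Y |X Y. X \<in> f ` A \<and> Y \<in> f ` B} = UNIV" .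
  have "f ` A \<inter> f ` B = f ` (A \<inter> B)"
    by (rule image_Int[symmetric]) (rule bij_is_inj[OF aut_or_anti_bij[OF f]])
  then show "f ` A \<inter> f ` B = {0}"
    using d by (simp add: direct_sum_decomposition_def aut_or_anti_zero[OF f])
qed

section \<open>Subalgebras complementary to M\<close>

definition complements_M :: "cmat3 set \<Rightarrow> bool"
  where "complements_M A \<longleftrightarrow> subalgebra A \<and> direct_sum_decomposition A M"

definition M_conjugate :: "cmat3 set \<Rightarrow> cmat3 set \<Rightarrow> bool"
  where "M_conjugate A A' \<longleftrightarrow> (\<exists>\<phi>. automorphism \<phi> \<and> \<phi> ` M = M \<and> \<phi> ` A = A')"

lemma M_conjugate_refl: "M_conjugate A A"
  unfolding M_conjugate_def by (rule exI[of _ id]) (simp add: automorphism_id)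

lemma M_conjugate_trans:
  assumes "M_conjugate A B" and "M_conjugate B C"
  shows "M_conjugate A C"
proof -
  obtain f g where "automorphism f" "f ` M = M" "f ` A = B" "automorphism g" "g ` M = M" "g ` B = C"
    using assms by (auto simp: M_conjugate_def)
  then show ?thesis
    unfolding M_conjugate_def by (intro exI[of _ "g \<circ> f"]) (simp add: automorphism_comp flip: image_image)
qed

lemma complements_M_add: "complements_M A \<Longrightarrow> X \<in> A \<Longrightarrow> Y \<in> A \<Longrightarrow> X + Y \<in> A"
  by (simp add: complements_M_def subalgebra_def cmat.subspace_add)

lemma complements_M_diff: "complements_M A \<Longrightarrow> X \<in> A \<Longrightarrow> Y \<in> A \<Longrightarrow> X - Y \<in> A"
  by (simp add: complements_M_def subalgebra_def cmat.subspace_diff)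

lemma complements_M_scale: "complements_M A \<Longrightarrow> X \<in> A \<Longrightarrow> c *\<^sub>C X \<in> A"
  by (simp add: complements_M_def subalgebra_def cmat.subspace_scale)

lemma complements_M_mult: "complements_M A \<Longrightarrow> X \<in> A \<Longrightarrow> Y \<in> A \<Longrightarrow> X ** Y \<in> A"
  by (simp add: complements_M_def subalgebra_def)

text \<open>The entries \<open>21, 31, 23, 32\<close> are coordinates on the quotient by \<open>M\<close>.\<close>
lemma complements_M_ex:
  assumes "complements_M A"
  obtains a b c e k where "m3 a b c p e r q s k \<in> A"
proof -
  have "m3 0 0 0 p 0 r q s 0 \<in> {X + Y |X Y. X \<in> A \<and> Y \<in> M}"
    using assms by (simp add: complements_M_def direct_sum_decomposition_def)
  then obtain X Y where X: "X \<in> A" and "Y \<in> M" "m3 0 0 0 p 0 r q s 0 = X + Y"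
    by blast
  then have "X $ 2 $ 1 = p" "X $ 3 $ 1 = q" "X $ 2 $ 3 = r" "X $ 3 $ 2 = s"
    by (auto simp: mem_M_iff cmat3_eq_iff)
  then show thesis
    using X m3_eta[of X] that by metis
qed

lemma complements_M_eqI:
  assumes A: "complements_M A" and "X \<in> A" "Y \<in> A"
    and "X $ 2 $ 1 = Y $ 2 $ 1" "X $ 3 $ 1 = Y $ 3 $ 1" "X $ 2 $ 3 = Y $ 2 $ 3" "X $ 3 $ 2 = Y $ 3 $ 2"
  shows "X = Y"
proof -
  have "X - Y \<in> A \<inter> M"
    using assms by (simp add: complements_M_diff mem_M_iff)
  also have "A \<inter> M = {0}"
    using A by (simp add: complements_M_def direct_sum_decomposition_def)
  finally show ?thesis by simp
qed

text \<open>
  Modulo \<open>M\<close>, the span of the four matrices is everything; a subspace of a complement of \<open>M\<close> with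
  this property is the whole complement.
\<close>
lemma complements_M_eq_span:
  assumes A: "complements_M A" and K: "{V1, V2, V3, V4} \<subseteq> A"
    and cover: "\<And>p q r s. \<exists>c1 c2 c3 c4.
      c1 *\<^sub>C V1 + c2 *\<^sub>C V2 + c3 *\<^sub>C V3 + c4 *\<^sub>C V4 - m3 0 0 0 p 0 r q s 0 \<in> M"
  shows "A = cmat.span {V1, V2, V3, V4}"
proof
  have sub: "cmat.subspace A"
    using A by (simp add: complements_M_def subalgebra_def)
  show span_le: "cmat.span {V1, V2, V3, V4} \<subseteq> A"
    by (rule cmat.span_minimal[OF K sub])
  show "A \<subseteq> cmat.span {V1, V2, V3, V4}"
  proof
    fix X assume X: "X \<in> A"
    obtain c1 c2 c3 c4 where c: "c1 *\<^sub>C V1 + c2 *\<^sub>C V2 + c3 *\<^sub>C V3 + c4 *\<^sub>C V4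
        - m3 0 0 0 (X $ 2 $ 1) 0 (X $ 2 $ 3) (X $ 3 $ 1) (X $ 3 $ 2) 0 \<in> M"
      using cover by blast
    let ?Y = "c1 *\<^sub>C V1 + c2 *\<^sub>C V2 + c3 *\<^sub>C V3 + c4 *\<^sub>C V4"
    have Y: "?Y \<in> cmat.span {V1, V2, V3, V4}"
      by (intro cmat.span_add cmat.span_scale cmat.span_base) auto
    have "X = ?Y"
      by (rule complements_M_eqI[OF A X]) (use Y span_le c in \<open>auto simp: mem_M_iff\<close>)
    with Y show "X \<in> cmat.span {V1, V2, V3, V4}" by simp
  qed
qed

text \<open>
  This turns closure under multiplication into equations: applied to a product of two of the four
  generators, it expresses the five entries in \<open>M\<close> of the product through the other four.
\<close>
lemma complements_M_entries:
  assumes A: "complements_M A"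
    and Z: "m3 z11 z12 z13 1 z22 0 0 0 z33 \<in> A" and W: "m3 w11 w12 w13 0 w22 0 1 0 w33 \<in> A"
    and P: "m3 p11 p12 p13 0 p22 1 0 0 p33 \<in> A" and Q: "m3 q11 q12 q13 0 q22 0 0 1 q33 \<in> A"
    and X: "m3 x11 x12 x13 x21 x22 x23 x31 x32 x33 \<in> A"
  shows "x11 = x21 * z11 + x31 * w11 + x23 * p11 + x32 * q11
    \<and> x12 = x21 * z12 + x31 * w12 + x23 * p12 + x32 * q12
    \<and> x13 = x21 * z13 + x31 * w13 + x23 * p13 + x32 * q13
    \<and> x22 = x21 * z22 + x31 * w22 + x23 * p22 + x32 * q22
    \<and> x33 = x21 * z33 + x31 * w33 + x23 * p33 + x32 * q33"
proof -
  let ?Y = "x21 *\<^sub>C m3 z11 z12 z13 1 z22 0 0 0 z33 + x31 *\<^sub>C m3 w11 w12 w13 0 w22 0 1 0 w33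
      + x23 *\<^sub>C m3 p11 p12 p13 0 p22 1 0 0 p33 + x32 *\<^sub>C m3 q11 q12 q13 0 q22 0 0 1 q33"
  have "m3 x11 x12 x13 x21 x22 x23 x31 x32 x33 = ?Y"
    by (rule complements_M_eqI[OF A X])
      (intro complements_M_add[OF A] complements_M_scale[OF A] Z W P Q, simp_all add: m3_simps)
  then show ?thesis
    by (simp add: m3_simps m3_eq_iff)
qed

section \<open>Conjugation by invertible elements of M\<close>

text \<open>
  Conjugation by an invertible element of \<open>M\<close>, scaled so that its \<open>11\<close> entry is \<open>1\<close>; the matrix on
  the right is the inverse of the one on the left when \<open>a\<close> and \<open>b\<close> are nonzero.
\<close>
definition M_conj :: "complex \<Rightarrow> complex \<Rightarrow> complex \<Rightarrow> complex \<Rightarrow> cmat3 \<Rightarrow> cmat3"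
  where "M_conj s t a b X =
    m3 1 s t 0 a 0 0 0 b ** X ** m3 1 (- s / a) (- t / b) 0 (1 / a) 0 0 0 (1 / b)"

lemma M_conj_m3:
  assumes "a \<noteq> 0" "b \<noteq> 0"
  shows "M_conj s t a b (m3 x11 x12 x13 x21 x22 x23 x31 x32 x33) =
      m3 (x11 + s * x21 + t * x31)
         ((x12 + s * x22 + t * x32 - s * (x11 + s * x21 + t * x31)) / a)
         ((x13 + s * x23 + t * x33 - t * (x11 + s * x21 + t * x31)) / b)
         (a * x21) (x22 - s * x21) (a * (x23 - t * x21) / b)
         (b * x31) (b * (x32 - s * x31) / a) (x33 - t * x31)"
  using assms by (simp add: M_conj_def m3_mult m3_eq_iff field_simps)

lemma
  assumes "a \<noteq> 0" "b \<noteq> 0"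
  shows automorphism_M_conj: "automorphism (M_conj s t a b)"
    and M_conj_image_M: "M_conj s t a b ` M = M"
proof -
  define g h where "g = m3 1 s t 0 a 0 0 0 b"
    and "h = m3 1 (- s / a) (- t / b) 0 (1 / a) 0 0 0 (1 / b)"
  have gh: "g ** h = mat 1" and hg: "h ** g = mat 1"
    using assms by (simp_all add: g_def h_def m3_mult m3_one m3_eq_iff)
  have f: "M_conj s t a b X = g ** X ** h" for X
    by (simp add: M_conj_def g_def h_def)
  have inverse: "M_conj s t a b (h ** X ** g) = X" "h ** M_conj s t a b X ** g = X" for X
    using gh hg by (simp_all add: f matrix_mul_assoc) (simp_all flip: matrix_mul_assoc)
  show "automorphism (M_conj s t a b)"
  proof (rule automorphismI)
    show "M_conj s t a b (X + Y) = M_conj s t a b X + M_conj s t a b Y" for X Y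
      by (simp add: f matrix_matrix_mult_def vec_eq_iff sum_3 algebra_simps)
    show "M_conj s t a b (c *\<^sub>C X) = c *\<^sub>C M_conj s t a b X" for c X
      by (simp add: f matrix_matrix_mult_def cscale_def vec_eq_iff sum_3 algebra_simps)
    show "bij (M_conj s t a b)"
      by (rule o_bij[of "\<lambda>X. h ** X ** g"]) (auto simp: fun_eq_iff inverse)
    show "M_conj s t a b (mat 1) = mat 1"
      by (simp add: f gh)
    show "M_conj s t a b (X ** Y) = M_conj s t a b X ** M_conj s t a b Y" for X Y
    proof -
      have "M_conj s t a b X ** M_conj s t a b Y = g ** X ** (h ** g) ** Y ** h"
        by (simp only: f matrix_mul_assoc)
      then show ?thesis
        by (simp add: f hg matrix_mul_assoc)
    qed
  qed
  have "M_conj s t a b X \<in> M \<and> h ** X ** g \<in> M" if "X \<in> M" for X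
    using that unfolding f
    by (subst (1 2) m3_eta[of X]) (simp add: g_def h_def m3_simps mem_M_iff)
  then show "M_conj s t a b ` M = M"
    using inverse(1) by (metis image_eqI image_subsetI subsetI subset_antisym)
qed

lemma M_conjugate_M_conj:
  assumes "a \<noteq> 0" "b \<noteq> 0"
  shows "M_conjugate A (M_conj s t a b ` A)"
  unfolding M_conjugate_def
  using automorphism_M_conj[OF assms] M_conj_image_M[OF assms] by blast

lemma complements_M_M_conjugate:
  assumes "complements_M A" and "M_conjugate A A'"
  shows "complements_M A'"
  using assms subalgebra_image[of _ A] direct_sum_decomposition_image[of _ A M]
  by (fastforce simp: complements_M_def M_conjugate_def)

section \<open>The stabilizer of the first basis line\<close>

text \<open>
  Products inside the stabilizer force \<open>p22 p33 = q22 q33 = p33 q33 = p22 q22 = 0\<close> and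
  \<open>p22 q33 + p33 q22 = 1\<close>. Hence either only \<open>p22\<close> and \<open>q33\<close> are nonzero or only \<open>p33\<close> and \<open>q22\<close> are;
  the surviving pair consists of mutually inverse numbers, and a diagonal conjugation makes both \<open>1\<close>.
\<close>
lemma first_column_stabilizer_block:
  assumes A: "complements_M A"
  obtains A' p11 p12 p13 q11 q12 q13 where "complements_M A'" and "M_conjugate A A'"
    and "m3 p11 p12 p13 0 1 1 0 0 0 \<in> A' \<and> m3 q11 q12 q13 0 0 0 0 1 1 \<in> A' \<or>
         m3 p11 p12 p13 0 0 1 0 0 1 \<in> A' \<and> m3 q11 q12 q13 0 1 0 0 1 0 \<in> A'"
proof -
  obtain z11 z12 z13 z22 z33 where Z: "m3 z11 z12 z13 1 z22 0 0 0 z33 \<in> A"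
    by (rule complements_M_ex[OF A])
  obtain w11 w12 w13 w22 w33 where W: "m3 w11 w12 w13 0 w22 0 1 0 w33 \<in> A"
    by (rule complements_M_ex[OF A])
  obtain p11 p12 p13 p22 p33 where P: "m3 p11 p12 p13 0 p22 1 0 0 p33 \<in> A"
    by (rule complements_M_ex[OF A])
  obtain q11 q12 q13 q22 q33 where Q: "m3 q11 q12 q13 0 q22 0 0 1 q33 \<in> A"
    by (rule complements_M_ex[OF A])
  note entries = complements_M_entries[OF A Z W P Q]
  note PP = entries[OF complements_M_mult[OF A P P, unfolded m3_mult]]
  note PQ = entries[OF complements_M_mult[OF A P Q, unfolded m3_mult]]
  note QP = entries[OF complements_M_mult[OF A Q P, unfolded m3_mult]]
  note QQ = entries[OF complements_M_mult[OF A Q Q, unfolded m3_mult]]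
  have eqs: "p22 * p33 = 0" "q22 * q33 = 0" "p33 * q33 = 0" "p22 * q22 = 0"
      "p22 * q33 + p33 * q22 = 1"
    using PP PQ QP QQ by (auto simp: algebra_simps)
  show thesis
  proof (cases "p22 = 0")
    case False
    then have block: "p33 = 0" "q22 = 0" "q33 = 1 / p22"
      using eqs by (auto simp: field_simps)
    let ?A' = "M_conj 0 0 p22 1 ` A"
    have conj: "M_conjugate A ?A'"
      by (rule M_conjugate_M_conj) (use False in simp_all)
    have A': "complements_M ?A'"
      by (rule complements_M_M_conjugate[OF A conj])
    show ?thesis
    proof (rule that[OF A' conj], rule disjI1, rule conjI)
      show "m3 (p11 / p22) (p12 / (p22 * p22)) (p13 / p22) 0 1 1 0 0 0 \<in> ?A'"
        using complements_M_scale[OF A' imageI[OF P], of "1 / p22"] False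
        by (simp add: M_conj_m3 m3_cscale block)
      show "m3 (p22 * q11) q12 (p22 * q13) 0 0 0 0 1 1 \<in> ?A'"
        using complements_M_scale[OF A' imageI[OF Q], of p22] False
        by (simp add: M_conj_m3 m3_cscale block)
    qed
  next
    case True
    then have block: "p33 \<noteq> 0" "q33 = 0"
      using eqs by auto
    then have q22: "q22 = 1 / p33"
      using eqs True by (simp add: field_simps)
    let ?A' = "M_conj 0 0 p33 1 ` A"
    have conj: "M_conjugate A ?A'"
      by (rule M_conjugate_M_conj) (use block(1) in simp_all)
    have A': "complements_M ?A'"
      by (rule complements_M_M_conjugate[OF A conj])
    show ?thesis
    proof (rule that[OF A' conj], rule disjI2, rule conjI)
      show "m3 (p11 / p33) (p12 / (p33 * p33)) (p13 / p33) 0 0 1 0 0 1 \<in> ?A'"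
        using complements_M_scale[OF A' imageI[OF P], of "1 / p33"] block(1)
        by (simp add: M_conj_m3 m3_cscale block q22 True)
      show "m3 (p33 * q11) q12 (p33 * q13) 0 1 0 0 1 0 \<in> ?A'"
        using complements_M_scale[OF A' imageI[OF Q], of p33] block(1)
        by (simp add: M_conj_m3 m3_cscale block q22 True)
    qed
  qed
qed

text \<open>
  Writing \<open>\<sigma>(X)\<close> for the row of entries \<open>12, 13\<close>, \<open>D(X)\<close> for the lower right block and \<open>e\<close> for the
  common \<open>11\<close> entry of the generators, unipotent conjugation with first row \<open>(1, v)\<close> replaces
  \<open>\<sigma>(X)\<close> by \<open>\<sigma>(X) + v D(X) - e v\<close> for \<open>X\<close> in \<open>{P, Q}\<close>. The products of \<open>P\<close> and \<open>Q\<close> leave just those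
  \<open>\<sigma>\<close> that some \<open>v\<close> removes; the \<open>v\<close> chosen in the proof solves these linear equations.
\<close>
lemma row_type_normal_form:
  assumes A: "complements_M A"
    and P: "m3 p11 p12 p13 0 1 1 0 0 0 \<in> A" and Q: "m3 q11 q12 q13 0 0 0 0 1 1 \<in> A"
  obtains A' e where "complements_M A'" and "M_conjugate A A'" and "e = 0 \<or> e = 1"
    and "m3 e 0 0 0 1 1 0 0 0 \<in> A'" and "m3 e 0 0 0 0 0 0 1 1 \<in> A'"
proof -
  obtain z11 z12 z13 z22 z33 where Z: "m3 z11 z12 z13 1 z22 0 0 0 z33 \<in> A"
    by (rule complements_M_ex[OF A])
  obtain w11 w12 w13 w22 w33 where W: "m3 w11 w12 w13 0 w22 0 1 0 w33 \<in> A"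
    by (rule complements_M_ex[OF A])
  note entries = complements_M_entries[OF A Z W P Q]
  note PP = entries[OF complements_M_mult[OF A P P, unfolded m3_mult]]
  note PQ = entries[OF complements_M_mult[OF A P Q, unfolded m3_mult]]
  note QP = entries[OF complements_M_mult[OF A Q P, unfolded m3_mult]]
  note QQ = entries[OF complements_M_mult[OF A Q Q, unfolded m3_mult]]
  have e: "q11 = p11" "p11 = 0 \<or> p11 = 1"
    using PP PQ QP QQ by (auto simp: algebra_simps)
  from e(2) show thesis
  proof
    assume 0: "p11 = 0"
    have row: "p13 = p12" "q13 = q12"
      using PP QQ by (auto simp: algebra_simps 0 e(1))
    let ?A' = "M_conj (- p12) (- q12) 1 1 ` A"
    have conj: "M_conjugate A ?A'"
      by (rule M_conjugate_M_conj) simp_all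
    have A': "complements_M ?A'"
      by (rule complements_M_M_conjugate[OF A conj])
    show thesis
      by (rule that[OF A' conj, of 0]) (use imageI[OF P, of "M_conj (- p12) (- q12) 1 1"] imageI[OF Q, of "M_conj (- p12) (- q12) 1 1"] in \<open>simp_all add: M_conj_m3 0 row e\<close>)
  next
    assume 1: "p11 = 1"
    have row: "p12 = 0" "q13 = 0" "q12 = - p13"
      using PP PQ QQ by (auto simp: algebra_simps 1 e(1) eq_neg_iff_add_eq_0)
    let ?A' = "M_conj (- p13) 0 1 1 ` A"
    have conj: "M_conjugate A ?A'"
      by (rule M_conjugate_M_conj) simp_all
    have A': "complements_M ?A'"
      by (rule complements_M_M_conjugate[OF A conj])
    show thesis
      by (rule that[OF A' conj, of 1]) (use imageI[OF P, of "M_conj (- p13) 0 1 1"] imageI[OF Q, of "M_conj (- p13) 0 1 1"] in \<open>simp_all add: M_conj_m3 1 row e\<close>)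
  qed
qed

text \<open>The same argument as for the row type.\<close>
lemma column_type_normal_form:
  assumes A: "complements_M A"
    and P: "m3 p11 p12 p13 0 0 1 0 0 1 \<in> A" and Q: "m3 q11 q12 q13 0 1 0 0 1 0 \<in> A"
  obtains A' e where "complements_M A'" and "M_conjugate A A'" and "e = 0 \<or> e = 1"
    and "m3 e 0 0 0 0 1 0 0 1 \<in> A'" and "m3 e 0 0 0 1 0 0 1 0 \<in> A'"
proof -
  obtain z11 z12 z13 z22 z33 where Z: "m3 z11 z12 z13 1 z22 0 0 0 z33 \<in> A"
    by (rule complements_M_ex[OF A])
  obtain w11 w12 w13 w22 w33 where W: "m3 w11 w12 w13 0 w22 0 1 0 w33 \<in> A"
    by (rule complements_M_ex[OF A])
  note entries = complements_M_entries[OF A Z W P Q]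
  note PP = entries[OF complements_M_mult[OF A P P, unfolded m3_mult]]
  note PQ = entries[OF complements_M_mult[OF A P Q, unfolded m3_mult]]
  note QP = entries[OF complements_M_mult[OF A Q P, unfolded m3_mult]]
  note QQ = entries[OF complements_M_mult[OF A Q Q, unfolded m3_mult]]
  have e: "q11 = p11" "p11 = 0 \<or> p11 = 1"
    using PP PQ QP QQ by (auto simp: algebra_simps)
  from e(2) show thesis
  proof
    assume 0: "p11 = 0"
    have row: "p12 = 0" "q13 = 0" "p13 = q12"
      using PP PQ QP QQ by (auto simp: algebra_simps 0 e(1))
    let ?A' = "M_conj (- q12) 0 1 1 ` A"
    have conj: "M_conjugate A ?A'"
      by (rule M_conjugate_M_conj) simp_all
    have A': "complements_M ?A'"
      by (rule complements_M_M_conjugate[OF A conj])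
    show thesis
      by (rule that[OF A' conj, of 0]) (use imageI[OF P, of "M_conj (- q12) 0 1 1"] imageI[OF Q, of "M_conj (- q12) 0 1 1"] in \<open>simp_all add: M_conj_m3 0 row e\<close>)
  next
    assume 1: "p11 = 1"
    have row: "p13 = - p12" "q13 = - q12"
      using PP PQ QQ by (auto simp: algebra_simps 1 e(1) eq_neg_iff_add_eq_0)
    let ?A' = "M_conj p12 (- q12) 1 1 ` A"
    have conj: "M_conjugate A ?A'"
      by (rule M_conjugate_M_conj) simp_all
    have A': "complements_M ?A'"
      by (rule complements_M_M_conjugate[OF A conj])
    show thesis
      by (rule that[OF A' conj, of 1]) (use imageI[OF P, of "M_conj p12 (- q12) 1 1"] imageI[OF Q, of "M_conj p12 (- q12) 1 1"] in \<open>simp_all add: M_conj_m3 1 row e\<close>)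
  qed
qed

section \<open>Extending the stabilizer to the whole complement\<close>

text \<open>
  Here \<open>Z\<close> and \<open>W\<close> are forced up to the single number \<open>z22\<close>, as \<open>Z = E 2 1 + z22 E 2 2\<close> and
  \<open>W = E 3 1 - z22 E 3 3\<close>. Conjugating by a diagonal matrix that is scalar on the lower block fixes
  \<open>P\<close> and \<open>Q\<close> and scales \<open>z22\<close>.
\<close>
lemma row_type_character_0:
  assumes A: "complements_M A"
    and P: "m3 0 0 0 0 1 1 0 0 0 \<in> A" and Q: "m3 0 0 0 0 0 0 0 1 1 \<in> A"
  shows "\<exists>S. M_conjugate A S \<and>
    (S = cmat.span {E 2 1, E 3 1, E 3 2 + E 3 3, E 2 2 + E 2 3} \<or>
     S = cmat.span {E 2 1 + E 2 2, E 3 1 - E 3 3, E 3 2 + E 3 3, E 2 2 + E 2 3})"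
proof -
  obtain z11 z12 z13 z22 z33 where Z: "m3 z11 z12 z13 1 z22 0 0 0 z33 \<in> A"
    by (rule complements_M_ex[OF A])
  obtain w11 w12 w13 w22 w33 where W: "m3 w11 w12 w13 0 w22 0 1 0 w33 \<in> A"
    by (rule complements_M_ex[OF A])
  note entries = complements_M_entries[OF A Z W P Q]
  note PZ = entries[OF complements_M_mult[OF A P Z, unfolded m3_mult]]
  note QZ = entries[OF complements_M_mult[OF A Q Z, unfolded m3_mult]]
  note PW = entries[OF complements_M_mult[OF A P W, unfolded m3_mult]]
  note QW = entries[OF complements_M_mult[OF A Q W, unfolded m3_mult]]
  note ZP = entries[OF complements_M_mult[OF A Z P, unfolded m3_mult]]
  note ZQ = entries[OF complements_M_mult[OF A Z Q, unfolded m3_mult]]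
  note WP = entries[OF complements_M_mult[OF A W P, unfolded m3_mult]]
  note WQ = entries[OF complements_M_mult[OF A W Q, unfolded m3_mult]]
  have z: "z11 = 0" "z12 = 0" "z13 = 0" "z33 = 0"
    and w: "w11 = 0" "w12 = 0" "w13 = 0" "w22 = 0" and "w33 + z22 = 0"
    using PZ QZ PW QW ZP ZQ WP WQ by (auto simp: algebra_simps)
  then have w33: "w33 = - z22"
    by (simp add: eq_neg_iff_add_eq_0)
  show ?thesis
  proof (cases "z22 = 0")
    case True
    have "A = cmat.span {E 2 1, E 3 1, E 3 2 + E 3 3, E 2 2 + E 2 3}"
    proof (rule complements_M_eq_span[OF A])
      show "{E 2 1, E 3 1, E 3 2 + E 3 3, E 2 2 + E 2 3} \<subseteq> A"
        using P Q Z W by (simp add: z w w33 True E_m3 m3_simps)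
      show "\<exists>c1 c2 c3 c4. c1 *\<^sub>C E 2 1 + c2 *\<^sub>C E 3 1 + c3 *\<^sub>C (E 3 2 + E 3 3)
          + c4 *\<^sub>C (E 2 2 + E 2 3) - m3 0 0 0 p 0 r q s 0 \<in> M" for p q r s
        by (intro exI[of _ p] exI[of _ q] exI[of _ s] exI[of _ r])
          (simp add: E_m3 m3_simps mem_M_iff)
    qed
    then show ?thesis
      using M_conjugate_refl by blast
  next
    case False
    let ?A' = "M_conj 0 0 z22 z22 ` A"
    have conj: "M_conjugate A ?A'"
      by (rule M_conjugate_M_conj) (use False in simp_all)
    have A': "complements_M ?A'"
      by (rule complements_M_M_conjugate[OF A conj])
    have "?A' = cmat.span {E 2 1 + E 2 2, E 3 1 - E 3 3, E 3 2 + E 3 3, E 2 2 + E 2 3}"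
    proof (rule complements_M_eq_span[OF A'])
      show "{E 2 1 + E 2 2, E 3 1 - E 3 3, E 3 2 + E 3 3, E 2 2 + E 2 3} \<subseteq> ?A'"
        using imageI[OF P, of "M_conj 0 0 z22 z22"] imageI[OF Q, of "M_conj 0 0 z22 z22"]
          complements_M_scale[OF A' imageI[OF Z], of "1 / z22"]
          complements_M_scale[OF A' imageI[OF W], of "1 / z22"] False
        by (simp add: z w w33 E_m3 m3_simps M_conj_m3)
      show "\<exists>c1 c2 c3 c4. c1 *\<^sub>C (E 2 1 + E 2 2) + c2 *\<^sub>C (E 3 1 - E 3 3) + c3 *\<^sub>C (E 3 2 + E 3 3)
          + c4 *\<^sub>C (E 2 2 + E 2 3) - m3 0 0 0 p 0 r q s 0 \<in> M" for p q r s
        by (intro exI[of _ p] exI[of _ q] exI[of _ s] exI[of _ r])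
          (simp add: E_m3 m3_simps mem_M_iff)
    qed
    with conj show ?thesis
      by metis
  qed
qed

text \<open>
  The products with the stabilizer leave \<open>Z\<close> and \<open>W\<close> with one common first row \<open>(z11, z12, z12)\<close> and
  zero diagonal below it. Unipotent conjugation with first row \<open>(1, \<tau>, \<tau>)\<close> fixes \<open>P\<close> and \<open>Q\<close> and, once
  the lower block of \<open>Z\<close> has been cleared again with a multiple of \<open>P\<close>, has the effect of adding \<open>2 \<tau>\<close> to \<open>z11\<close> and subtracting \<open>\<tau> z11 + \<tau>\<^sup>2\<close> from \<open>z12\<close>. So \<open>z11\<close> can be removed, and what remains
  is the invariant \<open>e = z12 + z11\<^sup>2 / 4\<close>. Diagonal conjugation by \<open>c\<close> divides it by \<open>c\<^sup>2\<close>.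
\<close>
lemma row_type_character_1:
  assumes A: "complements_M A"
    and P: "m3 1 0 0 0 1 1 0 0 0 \<in> A" and Q: "m3 1 0 0 0 0 0 0 1 1 \<in> A"
  shows "\<exists>S. M_conjugate A S \<and>
    (S = cmat.span {E 2 1, E 3 1, E 1 1 + E 2 2 + E 2 3, E 1 1 + E 3 2 + E 3 3} \<or>
     S = cmat.span {E 2 1 - E 3 1, E 1 2 + E 1 3 + E 3 1,
                    E 1 1 + E 3 2 + E 3 3, E 1 1 + E 2 2 + E 2 3})"
proof -
  obtain z11 z12 z13 z22 z33 where Z: "m3 z11 z12 z13 1 z22 0 0 0 z33 \<in> A"
    by (rule complements_M_ex[OF A])
  obtain w11 w12 w13 w22 w33 where W: "m3 w11 w12 w13 0 w22 0 1 0 w33 \<in> A"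
    by (rule complements_M_ex[OF A])
  note entries = complements_M_entries[OF A Z W P Q]
  note ZP = entries[OF complements_M_mult[OF A Z P, unfolded m3_mult]]
  note WP = entries[OF complements_M_mult[OF A W P, unfolded m3_mult]]
  note PW = entries[OF complements_M_mult[OF A P W, unfolded m3_mult]]
  have diag: "z22 = 0" "z33 = 0" "w22 = 0" "w33 = 0"
    using ZP WP by auto
  have row: "z13 = z12" "w13 = w12"
    using ZP WP by (auto simp: diag)
  have zw: "w11 = z11" "w12 = z12"
    using PW by (auto simp: diag row)
  define e where "e = z12 + z11 * z11 / 4"
  define \<tau> where "\<tau> = - z11 / 2"
  let ?A1 = "M_conj \<tau> \<tau> 1 1 ` A"
  have conj1: "M_conjugate A ?A1"
    by (rule M_conjugate_M_conj) simp_all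
  have A1: "complements_M ?A1"
    by (rule complements_M_M_conjugate[OF A conj1])
  have P1: "m3 1 0 0 0 1 1 0 0 0 \<in> ?A1"
    using imageI[OF P, of "M_conj \<tau> \<tau> 1 1"] by (simp add: M_conj_m3)
  have Q1: "m3 1 0 0 0 0 0 0 1 1 \<in> ?A1"
    using imageI[OF Q, of "M_conj \<tau> \<tau> 1 1"] by (simp add: M_conj_m3)
  \<comment> \<open>Conjugation spoils the lower block of \<open>Z\<close> and \<open>W\<close>; a multiple of \<open>P\<close> or \<open>Q\<close> repairs it.\<close>
  have Z1: "m3 0 e e 1 0 0 0 0 0 \<in> ?A1"
    using complements_M_add[OF A1 imageI[OF Z] complements_M_scale[OF A1 P1, of \<tau>]]
    by (simp add: M_conj_m3 m3_simps diag row zw e_def \<tau>_def algebra_simps power2_eq_square)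
  have W1: "m3 0 e e 0 0 0 1 0 0 \<in> ?A1"
    using complements_M_add[OF A1 imageI[OF W] complements_M_scale[OF A1 Q1, of \<tau>]]
    by (simp add: M_conj_m3 m3_simps diag row zw e_def \<tau>_def algebra_simps power2_eq_square)
  show ?thesis
  proof (cases "e = 0")
    case True
    have "?A1 = cmat.span {E 2 1, E 3 1, E 1 1 + E 2 2 + E 2 3, E 1 1 + E 3 2 + E 3 3}"
    proof (rule complements_M_eq_span[OF A1])
      show "{E 2 1, E 3 1, E 1 1 + E 2 2 + E 2 3, E 1 1 + E 3 2 + E 3 3} \<subseteq> ?A1"
        using P1 Q1 Z1 W1 by (simp add: True E_m3 m3_simps)
      show "\<exists>c1 c2 c3 c4. c1 *\<^sub>C E 2 1 + c2 *\<^sub>C E 3 1 + c3 *\<^sub>C (E 1 1 + E 2 2 + E 2 3)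
          + c4 *\<^sub>C (E 1 1 + E 3 2 + E 3 3) - m3 0 0 0 p 0 r q s 0 \<in> M" for p q r s
        by (intro exI[of _ p] exI[of _ q] exI[of _ s] exI[of _ r])
          (simp add: E_m3 m3_simps mem_M_iff)
    qed
    with conj1 show ?thesis
      by metis
  next
    case False
    define c where "c = csqrt e"
    have c: "c \<noteq> 0" "c * c = e"
      using False by (simp_all add: c_def flip: power2_eq_square)
    let ?A2 = "M_conj 0 0 c c ` ?A1"
    have conj2: "M_conjugate ?A1 ?A2"
      by (rule M_conjugate_M_conj) (use c in simp_all)
    have A2: "complements_M ?A2"
      by (rule complements_M_M_conjugate[OF A1 conj2])
    have P2: "m3 1 0 0 0 1 1 0 0 0 \<in> ?A2"
      using imageI[OF P1, of "M_conj 0 0 c c"] c by (simp add: M_conj_m3)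
    have Q2: "m3 1 0 0 0 0 0 0 1 1 \<in> ?A2"
      using imageI[OF Q1, of "M_conj 0 0 c c"] c by (simp add: M_conj_m3)
    have Z2: "m3 0 1 1 1 0 0 0 0 0 \<in> ?A2"
      using complements_M_scale[OF A2 imageI[OF Z1], of "1 / c"] c(1)
      by (simp add: M_conj_m3 m3_cscale flip: c(2))
    have W2: "m3 0 1 1 0 0 0 1 0 0 \<in> ?A2"
      using complements_M_scale[OF A2 imageI[OF W1], of "1 / c"] c(1)
      by (simp add: M_conj_m3 m3_cscale flip: c(2))
    have "?A2 = cmat.span {E 2 1 - E 3 1, E 1 2 + E 1 3 + E 3 1,
                    E 1 1 + E 3 2 + E 3 3, E 1 1 + E 2 2 + E 2 3}"
    proof (rule complements_M_eq_span[OF A2])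
      show "{E 2 1 - E 3 1, E 1 2 + E 1 3 + E 3 1,
          E 1 1 + E 3 2 + E 3 3, E 1 1 + E 2 2 + E 2 3} \<subseteq> ?A2"
        using P2 Q2 W2 complements_M_diff[OF A2 Z2 W2] by (simp add: E_m3 m3_simps)
      show "\<exists>c1 c2 c3 c4. c1 *\<^sub>C (E 2 1 - E 3 1) + c2 *\<^sub>C (E 1 2 + E 1 3 + E 3 1)
          + c3 *\<^sub>C (E 1 1 + E 3 2 + E 3 3) + c4 *\<^sub>C (E 1 1 + E 2 2 + E 2 3)
          - m3 0 0 0 p 0 r q s 0 \<in> M" for p q r s
        by (intro exI[of _ p] exI[of _ "p + q"] exI[of _ s] exI[of _ r])
          (simp add: E_m3 m3_simps mem_M_iff)
    qed
    with M_conjugate_trans[OF conj1 conj2] show ?thesis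
      by metis
  qed
qed

text \<open>
  Since \<open>Q Z\<close> has lower first column \<open>(1, 1)\<close>, it expresses \<open>W\<close> through \<open>Z\<close>; then \<open>Z\<^sup>2\<close> gives
  \<open>z12 = z11 z22\<close>. Unipotent conjugation with first row \<open>(1, \<tau>, - \<tau>)\<close> fixes \<open>P\<close> and \<open>Q\<close>, adds \<open>\<tau>\<close> to \<open>z11\<close>
  and subtracts it from \<open>z22\<close>. So \<open>z11\<close> can be removed, and what remains is the invariant
  \<open>c = z22 + z11\<close>, which diagonal conjugation scales.
\<close>
lemma column_type_character_0:
  assumes A: "complements_M A"
    and P: "m3 0 0 0 0 0 1 0 0 1 \<in> A" and Q: "m3 0 0 0 0 1 0 0 1 0 \<in> A"
  shows "\<exists>S. M_conjugate A S \<and>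
    (S = cmat.span {E 2 1, E 3 1, E 2 2 + E 3 2, E 2 3 + E 3 3} \<or>
     S = cmat.span {E 2 1 + E 2 2 - E 2 3, E 2 1 + E 3 1, E 2 2 + E 3 2, E 2 3 + E 3 3})"
proof -
  obtain z11 z12 z13 z22 z33 where Z: "m3 z11 z12 z13 1 z22 0 0 0 z33 \<in> A"
    by (rule complements_M_ex[OF A])
  obtain w11 w12 w13 w22 w33 where W: "m3 w11 w12 w13 0 w22 0 1 0 w33 \<in> A"
    by (rule complements_M_ex[OF A])
  note entries = complements_M_entries[OF A Z W P Q]
  note QZ = entries[OF complements_M_mult[OF A Q Z, unfolded m3_mult]]
  note ZP = entries[OF complements_M_mult[OF A Z P, unfolded m3_mult]]
  note ZZ = entries[OF complements_M_mult[OF A Z Z, unfolded m3_mult]]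
  have z: "z13 = - z12" "z33 = z22"
    using ZP by (simp_all add: eq_neg_iff_add_eq_0 add.commute)
  have "z11 + w11 = 0" "z12 + w12 = 0" "w13 - z12 = 0" "z22 + w22 = 0" "z22 + w33 = 0"
    using QZ by (simp_all add: z)
  then have w: "w11 = - z11" "w12 = - z12" "w13 = z12" "w22 = - z22" "w33 = - z22"
    by (simp_all add: eq_neg_iff_add_eq_0 add.commute)
  have z12: "z12 = z11 * z22"
    using ZZ by (auto simp: algebra_simps z w)
  define c where "c = z22 + z11"
  have neg_c: "- c = - z22 - z11"
    by (simp add: c_def)
  let ?A1 = "M_conj (- z11) z11 1 1 ` A"
  have conj1: "M_conjugate A ?A1"
    by (rule M_conjugate_M_conj) simp_all
  have A1: "complements_M ?A1"
    by (rule complements_M_M_conjugate[OF A conj1])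
  have P1: "m3 0 0 0 0 0 1 0 0 1 \<in> ?A1"
    using imageI[OF P, of "M_conj (- z11) z11 1 1"] by (simp add: M_conj_m3)
  have Q1: "m3 0 0 0 0 1 0 0 1 0 \<in> ?A1"
    using imageI[OF Q, of "M_conj (- z11) z11 1 1"] by (simp add: M_conj_m3)
  \<comment> \<open>The multiples of \<open>P\<close> and \<open>Q\<close> clear the entries \<open>23\<close> and \<open>32\<close> created by conjugation.\<close>
  have Z1: "m3 0 0 0 1 c 0 0 0 c \<in> ?A1"
    using complements_M_add[OF A1 imageI[OF Z] complements_M_scale[OF A1 P1, of z11]]
    by (simp add: M_conj_m3 m3_simps z z12 c_def algebra_simps)
  have W1: "m3 0 0 0 0 (- c) 0 1 0 (- c) \<in> ?A1"
    using complements_M_diff[OF A1 imageI[OF W] complements_M_scale[OF A1 Q1, of z11]]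
    by (simp add: M_conj_m3 m3_simps w z12 neg_c algebra_simps)
  show ?thesis
  proof (cases "c = 0")
    case True
    have "?A1 = cmat.span {E 2 1, E 3 1, E 2 2 + E 3 2, E 2 3 + E 3 3}"
    proof (rule complements_M_eq_span[OF A1])
      show "{E 2 1, E 3 1, E 2 2 + E 3 2, E 2 3 + E 3 3} \<subseteq> ?A1"
        using P1 Q1 Z1 W1 by (simp add: True E_m3 m3_simps)
      show "\<exists>c1 c2 c3 c4. c1 *\<^sub>C E 2 1 + c2 *\<^sub>C E 3 1 + c3 *\<^sub>C (E 2 2 + E 3 2)
          + c4 *\<^sub>C (E 2 3 + E 3 3) - m3 0 0 0 p 0 r q s 0 \<in> M" for p q r s
        by (intro exI[of _ p] exI[of _ q] exI[of _ s] exI[of _ r])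
          (simp add: E_m3 m3_simps mem_M_iff)
    qed
    with conj1 show ?thesis
      by metis
  next
    case False
    let ?A2 = "M_conj 0 0 c c ` ?A1"
    have conj2: "M_conjugate ?A1 ?A2"
      by (rule M_conjugate_M_conj) (use False in simp_all)
    have A2: "complements_M ?A2"
      by (rule complements_M_M_conjugate[OF A1 conj2])
    have P2: "m3 0 0 0 0 0 1 0 0 1 \<in> ?A2"
      using imageI[OF P1, of "M_conj 0 0 c c"] False by (simp add: M_conj_m3)
    have Q2: "m3 0 0 0 0 1 0 0 1 0 \<in> ?A2"
      using imageI[OF Q1, of "M_conj 0 0 c c"] False by (simp add: M_conj_m3)
    have Z2: "m3 0 0 0 1 1 0 0 0 1 \<in> ?A2"
      using complements_M_scale[OF A2 imageI[OF Z1], of "1 / c"] False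
      by (simp add: M_conj_m3 m3_cscale)
    have W2: "m3 0 0 0 0 (- 1) 0 1 0 (- 1) \<in> ?A2"
      using complements_M_scale[OF A2 imageI[OF W1], of "1 / c"] False
      by (simp add: M_conj_m3 m3_cscale)
    have "?A2 = cmat.span {E 2 1 + E 2 2 - E 2 3, E 2 1 + E 3 1, E 2 2 + E 3 2, E 2 3 + E 3 3}"
    proof (rule complements_M_eq_span[OF A2])
      show "{E 2 1 + E 2 2 - E 2 3, E 2 1 + E 3 1, E 2 2 + E 3 2, E 2 3 + E 3 3} \<subseteq> ?A2"
        using P2 Q2 complements_M_diff[OF A2 Z2 P2] complements_M_add[OF A2 Z2 W2]
        by (simp add: E_m3 m3_simps)
      show "\<exists>c1 c2 c3 c4. c1 *\<^sub>C (E 2 1 + E 2 2 - E 2 3) + c2 *\<^sub>C (E 2 1 + E 3 1)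
          + c3 *\<^sub>C (E 2 2 + E 3 2) + c4 *\<^sub>C (E 2 3 + E 3 3) - m3 0 0 0 p 0 r q s 0 \<in> M" for p q r s
        by (intro exI[of _ "p - q"] exI[of _ q] exI[of _ s] exI[of _ "r + p - q"])
          (simp add: E_m3 m3_simps mem_M_iff)
    qed
    with M_conjugate_trans[OF conj1 conj2] show ?thesis
      by metis
  qed
qed

text \<open>The products with the stabilizer leave no parameter at all: \<open>Z = E 2 1\<close> and \<open>W = E 3 1\<close>.\<close>
lemma column_type_character_1:
  assumes A: "complements_M A"
    and P: "m3 1 0 0 0 0 1 0 0 1 \<in> A" and Q: "m3 1 0 0 0 1 0 0 1 0 \<in> A"
  shows "A = cmat.span {E 2 1, E 3 1, E 1 1 + E 2 2 + E 3 2, E 1 1 + E 2 3 + E 3 3}"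
proof -
  obtain z11 z12 z13 z22 z33 where Z: "m3 z11 z12 z13 1 z22 0 0 0 z33 \<in> A"
    by (rule complements_M_ex[OF A])
  obtain w11 w12 w13 w22 w33 where W: "m3 w11 w12 w13 0 w22 0 1 0 w33 \<in> A"
    by (rule complements_M_ex[OF A])
  note entries = complements_M_entries[OF A Z W P Q]
  note PZ = entries[OF complements_M_mult[OF A P Z, unfolded m3_mult]]
  note QW = entries[OF complements_M_mult[OF A Q W, unfolded m3_mult]]
  note ZP = entries[OF complements_M_mult[OF A Z P, unfolded m3_mult]]
  note ZQ = entries[OF complements_M_mult[OF A Z Q, unfolded m3_mult]]
  note WP = entries[OF complements_M_mult[OF A W P, unfolded m3_mult]]
  note WQ = entries[OF complements_M_mult[OF A W Q, unfolded m3_mult]]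
  have zero: "z11 = 0" "z12 = 0" "z13 = 0" "z22 = 0" "z33 = 0"
    "w11 = 0" "w12 = 0" "w13 = 0" "w22 = 0" "w33 = 0"
    using PZ QW ZP ZQ WP WQ by (auto simp: algebra_simps)
  show ?thesis
  proof (rule complements_M_eq_span[OF A])
    show "{E 2 1, E 3 1, E 1 1 + E 2 2 + E 3 2, E 1 1 + E 2 3 + E 3 3} \<subseteq> A"
      using P Q Z W by (simp add: zero E_m3 m3_simps)
    show "\<exists>c1 c2 c3 c4. c1 *\<^sub>C E 2 1 + c2 *\<^sub>C E 3 1 + c3 *\<^sub>C (E 1 1 + E 2 2 + E 3 2)
        + c4 *\<^sub>C (E 1 1 + E 2 3 + E 3 3) - m3 0 0 0 p 0 r q s 0 \<in> M" for p q r s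
      by (intro exI[of _ p] exI[of _ q] exI[of _ s] exI[of _ r])
        (simp add: E_m3 m3_simps mem_M_iff)
  qed
qed

section \<open>The classification\<close>

lemma complements_M_classification:
  assumes A: "complements_M A"
  shows "\<exists>S. M_conjugate A S \<and>
    (S = cmat.span {E 2 1, E 3 1, E 3 2 + E 3 3, E 2 2 + E 2 3} \<or>
     S = cmat.span {E 2 1, E 3 1, E 2 2 + E 3 2, E 2 3 + E 3 3} \<or>
     S = cmat.span {E 2 1, E 3 1, E 1 1 + E 2 2 + E 2 3, E 1 1 + E 3 2 + E 3 3} \<or>
     S = cmat.span {E 2 1, E 3 1, E 1 1 + E 2 2 + E 3 2, E 1 1 + E 2 3 + E 3 3} \<or>
     S = cmat.span {E 2 1 + E 2 2, E 3 1 - E 3 3, E 3 2 + E 3 3, E 2 2 + E 2 3} \<or>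
     S = cmat.span {E 2 1 - E 3 1, E 1 2 + E 1 3 + E 3 1,
                    E 1 1 + E 3 2 + E 3 3, E 1 1 + E 2 2 + E 2 3} \<or>
     S = cmat.span {E 2 1 + E 2 2 - E 2 3, E 2 1 + E 3 1, E 2 2 + E 3 2, E 2 3 + E 3 3})"
    (is "\<exists>S. M_conjugate A S \<and> ?listed S")
proof -
  obtain A1 p11 p12 p13 q11 q12 q13 where A1: "complements_M A1" and AA1: "M_conjugate A A1"
    and type: "m3 p11 p12 p13 0 1 1 0 0 0 \<in> A1 \<and> m3 q11 q12 q13 0 0 0 0 1 1 \<in> A1 \<or>
         m3 p11 p12 p13 0 0 1 0 0 1 \<in> A1 \<and> m3 q11 q12 q13 0 1 0 0 1 0 \<in> A1"
    by (rule first_column_stabilizer_block[OF A])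
  have "\<exists>A2 S. M_conjugate A1 A2 \<and> M_conjugate A2 S \<and> ?listed S"
    using type
  proof (elim disjE conjE)
    assume "m3 p11 p12 p13 0 1 1 0 0 0 \<in> A1" "m3 q11 q12 q13 0 0 0 0 1 1 \<in> A1"
    then obtain A2 e where A2: "complements_M A2" "M_conjugate A1 A2" and e: "e = 0 \<or> e = 1"
      and PQ: "m3 e 0 0 0 1 1 0 0 0 \<in> A2" "m3 e 0 0 0 0 0 0 1 1 \<in> A2"
      by (rule row_type_normal_form[OF A1])
    have "\<exists>S. M_conjugate A2 S \<and> ?listed S"
      using e row_type_character_0[OF A2(1)] row_type_character_1[OF A2(1)] PQ by blast
    with A2(2) show ?thesis by blast
  next
    assume "m3 p11 p12 p13 0 0 1 0 0 1 \<in> A1" "m3 q11 q12 q13 0 1 0 0 1 0 \<in> A1"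
    then obtain A2 e where A2: "complements_M A2" "M_conjugate A1 A2" and e: "e = 0 \<or> e = 1"
      and PQ: "m3 e 0 0 0 0 1 0 0 1 \<in> A2" "m3 e 0 0 0 1 0 0 1 0 \<in> A2"
      by (rule column_type_normal_form[OF A1])
    have "\<exists>S. M_conjugate A2 S \<and> ?listed S"
      using e column_type_character_0[OF A2(1)] column_type_character_1[OF A2(1)] PQ
        M_conjugate_refl[of A2] by blast
    with A2(2) show ?thesis by blast
  qed
  then obtain A2 S where "M_conjugate A1 A2" "M_conjugate A2 S" and S: "?listed S"
    by blast
  then have "M_conjugate A S"
    using AA1 M_conjugate_trans by blast
  with S show ?thesis by blast
qed

theorem theorem7:
  fixes A B :: "(complex ^ 3 ^ 3) set"
  assumes "subalgebra A" and "subalgebra B"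
    and "direct_sum_decomposition A B"
    and "cmat.dim A = 4" and "cmat.dim B = 5"
    and "\<exists>\<psi>. (automorphism \<psi> \<or> antiautomorphism \<psi>) \<and> B = \<psi> ` M"
  shows "\<exists>\<phi> S. (automorphism \<phi> \<or> antiautomorphism \<phi>) \<and> \<phi> ` B = M \<and> \<phi> ` A = S \<and>
    (S = cmat.span {E 2 1, E 3 1, E 3 2 + E 3 3, E 2 2 + E 2 3}
   \<or> S = cmat.span {E 2 1, E 3 1, E 2 2 + E 3 2, E 2 3 + E 3 3}
   \<or> S = cmat.span {E 2 1, E 3 1, E 1 1 + E 2 2 + E 2 3, E 1 1 + E 3 2 + E 3 3}
   \<or> S = cmat.span {E 2 1, E 3 1, E 1 1 + E 2 2 + E 3 2, E 1 1 + E 2 3 + E 3 3}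
   \<or> S = cmat.span {E 2 1 + E 2 2, E 3 1 - E 3 3, E 3 2 + E 3 3, E 2 2 + E 2 3}
   \<or> S = cmat.span {E 2 1 - E 3 1, E 1 2 + E 1 3 + E 3 1,
                    E 1 1 + E 3 2 + E 3 3, E 1 1 + E 2 2 + E 2 3}
   \<or> S = cmat.span {E 2 1 - E 2 3, E 1 1 + E 2 1 + E 3 1,
                    E 1 2 + E 2 2 + E 3 2, E 1 3 + E 2 3 + E 3 3}
   \<or> S = cmat.span {E 2 1 + E 2 2 + E 3 3, E 2 1 + E 3 1,
                    E 1 1 + E 1 2 - E 1 3 + E 2 2 + E 3 2,
                    E 2 2 - E 2 3 + E 3 2 - E 3 3}
   \<or> (\<exists>x. S = cmat.span {E 2 1 + E 2 2 - (x + 1) *\<^sub>C E 2 3,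
                    x *\<^sub>C E 1 1 + E 2 1 + E 3 1,
                    x *\<^sub>C E 1 2 + E 2 2 + E 3 2,
                    x *\<^sub>C E 1 3 + E 2 3 + E 3 3})
   \<or> (\<exists>d. S = cmat.span {E 2 1 + d *\<^sub>C E 2 2,
                    E 1 1 + E 3 1 + d *\<^sub>C (E 1 2 + E 3 2),
                    E 2 2 + E 2 3,
                    E 1 2 + E 1 3 + E 3 2 + E 3 3})
   \<or> (\<exists>c. S = cmat.span {E 2 1 - E 3 1 + E 2 2 + E 3 3,
                    c *\<^sub>C (E 1 2 + E 1 3) + E 2 1 + E 2 2,
                    E 1 1 + E 1 2 + E 3 2 + E 3 3,
                    E 1 1 - E 1 3 + E 2 2 + E 2 3}))"
proof -
  obtain \<psi> where \<psi>: "automorphism \<psi> \<or> antiautomorphism \<psi>" and B: "B = \<psi> ` M"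
    using assms(6) by blast
  have inv_\<psi>: "automorphism (inv \<psi>) \<or> antiautomorphism (inv \<psi>)"
    using \<psi> automorphism_inv antiautomorphism_inv by blast
  have inv_B: "inv \<psi> ` B = M"
    using aut_or_anti_bij[OF \<psi>] by (simp add: B bij_is_inj image_image)
  have "complements_M (inv \<psi> ` A)"
    using subalgebra_image[OF inv_\<psi> assms(1)]
      direct_sum_decomposition_image[OF inv_\<psi> assms(3)]
    by (simp add: complements_M_def inv_B)
  from complements_M_classification[OF this] obtain S where
    conj: "M_conjugate (inv \<psi> ` A) S"
    and S: "S = cmat.span {E 2 1, E 3 1, E 3 2 + E 3 3, E 2 2 + E 2 3} \<or>
     S = cmat.span {E 2 1, E 3 1, E 2 2 + E 3 2, E 2 3 + E 3 3} \<or>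
     S = cmat.span {E 2 1, E 3 1, E 1 1 + E 2 2 + E 2 3, E 1 1 + E 3 2 + E 3 3} \<or>
     S = cmat.span {E 2 1, E 3 1, E 1 1 + E 2 2 + E 3 2, E 1 1 + E 2 3 + E 3 3} \<or>
     S = cmat.span {E 2 1 + E 2 2, E 3 1 - E 3 3, E 3 2 + E 3 3, E 2 2 + E 2 3} \<or>
     S = cmat.span {E 2 1 - E 3 1, E 1 2 + E 1 3 + E 3 1,
                    E 1 1 + E 3 2 + E 3 3, E 1 1 + E 2 2 + E 2 3} \<or>
     S = cmat.span {E 2 1 + E 2 2 - E 2 3, E 2 1 + E 3 1, E 2 2 + E 3 2, E 2 3 + E 3 3}"
    by blast
  obtain \<rho> where \<rho>: "automorphism \<rho>" "\<rho> ` M = M" "\<rho> ` inv \<psi> ` A = S"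
    using conj by (auto simp: M_conjugate_def)
  have "automorphism (\<rho> \<circ> inv \<psi>) \<or> antiautomorphism (\<rho> \<circ> inv \<psi>)"
    using inv_\<psi> \<rho>(1) automorphism_comp antiautomorphism_comp by blast
  moreover have "(\<rho> \<circ> inv \<psi>) ` B = M" "(\<rho> \<circ> inv \<psi>) ` A = S"
    using \<rho> inv_B by (simp_all only: image_comp[symmetric])
  \<comment> \<open>The last normal form is the member \<open>x = 0\<close> of the family (Y9).\<close>
  moreover have "\<exists>x. S = cmat.span {E 2 1 + E 2 2 - (x + 1) *\<^sub>C E 2 3, x *\<^sub>C E 1 1 + E 2 1 + E 3 1,
       x *\<^sub>C E 1 2 + E 2 2 + E 3 2, x *\<^sub>C E 1 3 + E 2 3 + E 3 3}"
    if "S = cmat.span {E 2 1 + E 2 2 - E 2 3, E 2 1 + E 3 1, E 2 2 + E 3 2, E 2 3 + E 3 3}"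
    by (rule exI[of _ 0]) (simp add: that)
  ultimately show ?thesis
    using S by - (rule exI[of _ "\<rho> \<circ> inv \<psi>"], rule exI[of _ S], intro conjI, assumption+, argo)
qed

end
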